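(* Let $q$ be a prime power and let $f_1(x),f_2(x)$ be irreducible polynomials over $\mathbb{F}_q$ of the same degree, with roots $\omega_1,\omega_2$ (in an algebraic closure of $\mathbb{F}_q$) of the same multiplicative order. Then $\mathbb{F}_q[x]/(f_1(x))$ admits an $\eta$-covering if and only if $\mathbb{F}_q[x]/(f_2(x))$ admits an $\eta$-covering.
   Context: For an irreducible polynomial $f$ over $\mathbb{F}_q$ with nonzero root $\omega$, let $\eta:\mathbb{F}_q[x]/(f(x))\to\mathbb{F}_q[x]/(f(x))$ be the $\mathbb{F}_q$-linear map $g(x)+(f(x))\mapsto xg(x)+(f(x))$, whose order $T$ equals the multiplicative order of $\omega$. "$\mathbb{F}_q[x]/(f(x))$ admits an $\eta$-covering" means there is a proper $\mathbb{F}_q$-subspace $U$ with $\bigcup_{i=0}^{T-1}\eta^i(U)=\mathbb{F}_q[x]/(f(x))$. *)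

theory Defs
  imports "HOL-Algebra.Algebraic_Closure" "HOL-Number_Theory.Prime_Powers"
begin

text \<open>
  The finite field \<open>K\<close> is a subfield of an ambient ring \<open>L\<close> (its algebraic closure in the
  applications), so polynomials over \<open>K\<close> can be evaluated in \<open>L\<close> directly;
  \<open>Rupt\<^bsub>L\<^esub> K f\<close> is the quotient of \<open>K[X]\<^bsub>L\<^esub>\<close> by the ideal generated by \<open>f\<close>.
\<close>

text \<open>
  The map \<open>g + (f) \<mapsto> x g + (f)\<close>, written as multiplication by the class of \<open>x\<close>;
  \<open>eta_coset\<close> below is its description on representatives.
\<close>

definition (in ring) eta :: "'a set \<Rightarrow> 'a list \<Rightarrow> 'a list set \<Rightarrow> 'a list set"
  where "eta K f A = rupture_surj K f X \<otimes>\<^bsub>Rupt K f\<^esub> A"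

lemma (in domain) eta_coset:
  assumes "subfield K R" "f \<in> carrier (K[X])" "g \<in> carrier (K[X])"
  shows "eta K f (rupture_surj K f g) = rupture_surj K f (X \<otimes>\<^bsub>K[X]\<^esub> g)"
proof -
  have K: "subring K R"
    using subfieldE(1)[OF assms(1)] .
  have "rupture_surj K f \<in> ring_hom (K[X]) (Rupt K f)"
    using rupture_surj_hom(1)[OF K assms(2)] .
  from ring_hom_mult[OF this var_closed(1)[OF K] assms(3)] show ?thesis
    unfolding eta_def by simp
qed

definition (in ring) eta_order :: "'a set \<Rightarrow> 'a list \<Rightarrow> nat"
  where "eta_order K f = (LEAST n. 0 < n \<and> (\<forall>A \<in> carrier (Rupt K f). (eta K f ^^ n) A = A))"

text \<open>
  \<open>subalgebra F U Q\<close> says that \<open>U\<close> is an additive subgroup of \<open>Q\<close> closed under multiplication by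
  elements of \<open>F\<close>, i.e. an \<open>F\<close>-subspace of \<open>Q\<close>; here the scalars \<open>F\<close> are the image of \<open>K\<close>
  in the quotient.
\<close>

definition (in ring) admits_eta_covering :: "'a set \<Rightarrow> 'a list \<Rightarrow> bool"
  where "admits_eta_covering K f \<longleftrightarrow>
    (\<exists>U. subalgebra (rupture_surj K f ` poly_of_const ` K) U (Rupt K f) \<and>
         U \<noteq> carrier (Rupt K f) \<and>
         (\<Union>i \<in> {0..<eta_order K f}. (eta K f ^^ i) ` U) = carrier (Rupt K f))"

end

theory Submission
  imports Defs
begin

text \<open>
  Evaluation at the root \<open>\<omega>\<close> identifies \<open>Rupt K f\<close> with \<open>K(\<omega>)\<close> and \<open>eta\<close> with multiplication by
  \<open>\<omega>\<close>, so an \<open>\<eta>\<close>-covering is a proper subspace of \<open>K(\<omega>)\<close> whose translates by the powers of \<open>\<omega>\<close>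
  fill \<open>K(\<omega>)\<close>. If \<open>\<omega>1\<close> and \<open>\<omega>2\<close> have the same order \<open>T\<close>, the powers of either one are all the
  \<open>T\<close>-th roots of unity. Hence each is a power of the other, \<open>K(\<omega>1) = K(\<omega>2)\<close>, and the two covering
  conditions coincide.
\<close>

hide_const (open) Ring_Divisibility.mult_of \<comment> \<open>a second copy of \<open>Multiplicative_Group.mult_of\<close>\<close>

section \<open>Finite fields and roots of unity\<close>

lemma (in ring) dimension_imp_finite:
  assumes "dimension n K E" and "finite K"
  shows "finite E"
  using assms
proof (induction rule: dimension.induct)
  case zero_dim
  then show ?case by simp
next
  case (Suc_dim v E n K)
  have "line_extension K v E = (\<lambda>(k, u). k \<otimes> v \<oplus> u) ` (K \<times> E)"
    by (force simp: line_extension_mem_iff)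
  with Suc_dim.IH Suc_dim.prems show ?case by simp
qed

text \<open>The powers of \<open>a\<close> below its order \<open>T\<close> are \<open>T\<close>
  distinct roots of \<open>X^T - 1\<close>, which has at most \<open>T\<close> roots in a field. The
  resulting set thus depends on \<open>a\<close> only through \<open>T\<close>.\<close>

lemma (in field) powers_eq_roots_of_unity:
  assumes "finite (carrier R)" and "a \<in> carrier (mult_of R)"
  shows "(\<lambda>i::nat. a [^] i) ` {0..<group.ord (mult_of R) a}
    = {x \<in> carrier R. x [^] group.ord (mult_of R) a = \<one>}"
proof -
  interpret M: group "mult_of R"
    by (rule field_mult_group)
  let ?T = "M.ord a"
  have fin: "finite (carrier (mult_of R))"
    using assms(1) by simp
  have T: "?T > 0"
    using M.ord_ge_1[OF fin assms(2)] by simp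
  have a: "a \<in> carrier R"
    using assms(2) by simp
  have "inj_on (\<lambda>i::nat. a [^] i) {0..<?T}"
  proof -
    \<comment> \<open>\<open>M.ord_inj\<close> is stated for the closed interval ending at
      \<open>T - 1\<close>; the two intervals agree because \<open>T\<close> is positive.\<close>
    have "{0..<?T} = {0..?T - 1}"
      using T by auto
    then show ?thesis
      using M.ord_inj[OF assms(2)] by (simp add: Multiplicative_Group.nat_pow_mult_of)
  qed
  then have "card ((\<lambda>i::nat. a [^] i) ` {0..<?T}) = ?T"
    by (simp add: card_image)
  then have card: "card {x \<in> carrier R. x [^] ?T = \<one>} \<le> card ((\<lambda>i::nat. a [^] i) ` {0..<?T})"
    using num_roots_le_deg[OF assms(1), of ?T] T by simp
  have "(\<lambda>i::nat. a [^] i) ` {0..<?T} \<subseteq> {x \<in> carrier R. x [^] ?T = \<one>}"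
  proof safe
    fix i :: nat
    show "a [^] i \<in> carrier R"
      using a by simp
    have "a [^] ?T = \<one>"
      using M.pow_ord_eq_1[OF assms(2)] by (simp add: Multiplicative_Group.nat_pow_mult_of)
    then show "(a [^] i) [^] ?T = \<one>"
      using a by (metis mult.commute nat_pow_pow nat_pow_one)
  qed
  then show ?thesis
    using card_seteq[OF _ _ card] assms(1) by simp
qed

text \<open>The order is determined by which powers equal one, and restricting the carrier changes
  neither powers nor one.\<close>

lemma (in field) ord_mult_of_subfield:
  assumes "subfield M R"
  shows "group.ord (mult_of (R \<lparr> carrier := M \<rparr>)) x = group.ord (mult_of R) x"
proof -
  have "group (mult_of (R \<lparr> carrier := M \<rparr>))"
    using field.field_mult_group[OF subfield_iff(2)[OF assms]] .
  then show ?thesis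
    by (simp add: group.ord_def field_mult_group Multiplicative_Group.nat_pow_mult_of
        nat_pow_consistent[symmetric])
qed

text \<open>The ambient field may be infinite, so roots of unity are counted in a finite subfield
  containing both elements. Its finiteness also makes the order positive.\<close>

lemma (in field) powers_eq_if_same_ord:
  assumes "subfield M R" "finite M" and "a \<in> M" "a \<noteq> \<zero>" "b \<in> M" "b \<noteq> \<zero>"
    and "group.ord (mult_of R) a = group.ord (mult_of R) b"
  shows "(\<lambda>i::nat. a [^] i) ` {0..<group.ord (mult_of R) a}
       = (\<lambda>i::nat. b [^] i) ` {0..<group.ord (mult_of R) b}"
    and "group.ord (mult_of R) a > 0"
proof -
  interpret M: field "R \<lparr> carrier := M \<rparr>"
    by (rule subfield_iff(2)[OF assms(1)])
  interpret MG: group "mult_of (R \<lparr> carrier := M \<rparr>)"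
    by (rule M.field_mult_group)
  have ab: "a \<in> carrier (mult_of (R \<lparr> carrier := M \<rparr>))" "b \<in> carrier (mult_of (R \<lparr> carrier := M \<rparr>))"
    using assms by auto
  have fin: "finite (carrier (R \<lparr> carrier := M \<rparr>))"
    using assms(2) by simp
  show "(\<lambda>i::nat. a [^] i) ` {0..<group.ord (mult_of R) a}
      = (\<lambda>i::nat. b [^] i) ` {0..<group.ord (mult_of R) b}"
    using M.powers_eq_roots_of_unity[OF fin ab(1)] M.powers_eq_roots_of_unity[OF fin ab(2)]
    unfolding ord_mult_of_subfield[OF assms(1)] assms(7) nat_pow_consistent[symmetric] by simp
  show "group.ord (mult_of R) a > 0"
    using MG.ord_ge_1[OF _ ab(1)] fin by (simp add: ord_mult_of_subfield[OF assms(1)])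
qed

section \<open>From the quotient to the simple extension\<close>

text \<open>Since \<open>h\<close> turns scaling by \<open>k\<close> into scaling by
  \<open>h k\<close>, subspaces can be pulled back. This serves to carry a covering subspace of
  K(\<omega>) back to the quotient.\<close>

lemma (in ring_hom_ring) vimage_is_subalgebra:
  assumes "K \<subseteq> carrier R" and "subalgebra (h ` K) V S"
  shows "subalgebra K {a \<in> carrier R. h a \<in> V} R"
proof -
  interpret V: subalgebra "h ` K" V S
    by (rule assms(2))
  show ?thesis
  proof (intro subalgebra.intro R.add.subgroupI)
    \<comment> \<open>The underlying subgroup is additive, so \<open>V.one_closed\<close> says that
      zero lies in \<open>V\<close>.\<close>
    show "{a \<in> carrier R. h a \<in> V} \<noteq> {}"
      using V.one_closed by (auto intro: exI[of _ "\<zero>\<^bsub>R\<^esub>"])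
    show "\<ominus>\<^bsub>R\<^esub> a \<in> {a \<in> carrier R. h a \<in> V}" if "a \<in> {a \<in> carrier R. h a \<in> V}" for a
      using V.m_inv_closed[of "h a"] that by (simp add: a_inv_def[symmetric])
    show "a \<oplus>\<^bsub>R\<^esub> b \<in> {a \<in> carrier R. h a \<in> V}"
      if "a \<in> {a \<in> carrier R. h a \<in> V}" "b \<in> {a \<in> carrier R. h a \<in> V}" for a b
      using V.m_closed[of "h a" "h b"] that by simp
    show "subalgebra_axioms K {a \<in> carrier R. h a \<in> V} R"
      using V.smult_closed assms(1) by (auto simp: subalgebra_axioms_def)
  qed auto
qed

text \<open>The kernel is generated by the minimal polynomial \<open>Irr K \<omega>\<close>. As
  \<open>f\<close> is irreducible and lies in this ideal, it is associated to the generator; it need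
  not be monic.\<close>

lemma (in domain) pirreducible_generates_ker:
  assumes K: "subfield K R" and f: "f \<in> carrier (K[X])" "pirreducible K f"
    and root: "is_root f \<omega>"
  shows "a_kernel (K[X]) R (\<lambda>p. eval p \<omega>) = PIdl\<^bsub>K[X]\<^esub> f"
proof -
  interpret UP: principal_domain "K[X]"
    using univ_poly_is_principal[OF K] .
  have \<omega>: "\<omega> \<in> carrier R" and ev: "eval f \<omega> = \<zero>" "f \<noteq> []"
    using root unfolding is_root_def by auto
  have alg: "(algebraic over K) \<omega>"
    using algebraicI[OF f(1) ev(2,1)] .
  note irr = IrrE[OF K \<omega> alg]
  have "f \<in> PIdl\<^bsub>K[X]\<^esub> (Irr K \<omega>)"
    using Irr_generates_ker[OF K \<omega> alg] f(1) ev(1) unfolding a_kernel_def' by auto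
  then have "Irr K \<omega> \<sim>\<^bsub>K[X]\<^esub> f"
    using cgenideal_pirreducible[OF K irr(1,2) f(2)] by simp
  then show ?thesis
    using Irr_generates_ker[OF K \<omega> alg] UP.associated_iff_same_ideal[OF irr(1) f(1)] by simp
qed

text \<open>This is the first isomorphism theorem for evaluation at \<omega>, with kernel generated
  by \<open>f\<close> and image K(\<omega>).\<close>

lemma (in domain) rupture_eval:
  assumes K: "subfield K R" and f: "f \<in> carrier (K[X])" "pirreducible K f"
    and root: "is_root f \<omega>"
  obtains \<phi> where "ring_hom_ring (Rupt K f) R \<phi>"
    and "inj_on \<phi> (carrier (Rupt K f))"
    and "\<phi> ` carrier (Rupt K f) = simple_extension K \<omega>"
    and "\<And>p. p \<in> carrier (K[X]) \<Longrightarrow> \<phi> (rupture_surj K f p) = eval p \<omega>"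
proof
  have \<omega>: "\<omega> \<in> carrier R"
    using root unfolding is_root_def by auto
  have Ks: "subring K R"
    using subfieldE(1)[OF K] .
  interpret E: ring_hom_ring "K[X]" R "\<lambda>p. eval p \<omega>"
    using eval_ring_hom[OF Ks \<omega>] .
  interpret Q: ring_hom_ring "K[X]" "Rupt K f" "rupture_surj K f"
    using rupture_surj_hom(2)[OF Ks f(1)] .
  note ker = pirreducible_generates_ker[OF K f root]
  \<comment> \<open>All representatives of a coset take the same value at \<omega>, so the image is
    a singleton.\<close>
  let ?\<phi> = "\<lambda>A. the_elem ((\<lambda>p. eval p \<omega>) ` A)"
  have "?\<phi> \<in> ring_iso (Rupt K f) (R \<lparr> carrier := (\<lambda>p. eval p \<omega>) ` carrier (K[X]) \<rparr>)"
    using E.FactRing_iso_set_aux unfolding ker rupture_def .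
  then have iso: "?\<phi> \<in> ring_iso (Rupt K f) (R \<lparr> carrier := simple_extension K \<omega> \<rparr>)"
    using simple_extension_as_eval_img[OF subringE(1)[OF Ks] \<omega>] by simp
  have "simple_extension K \<omega> \<subseteq> carrier R"
    using simple_extension_in_carrier[OF subringE(1)[OF Ks] \<omega>] .
  with iso have "?\<phi> \<in> ring_hom (Rupt K f) R"
    unfolding ring_iso_def ring_hom_def by auto
  then show "ring_hom_ring (Rupt K f) R ?\<phi>"
    by (intro ring_hom_ringI2 Q.S.ring_axioms ring_axioms)
  show "inj_on ?\<phi> (carrier (Rupt K f))"
    and "?\<phi> ` carrier (Rupt K f) = simple_extension K \<omega>"
    using iso unfolding ring_iso_def bij_betw_def by auto
  show "?\<phi> (rupture_surj K f p) = eval p \<omega>" if "p \<in> carrier (K[X])" for p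
    using E.the_elem_simp[OF that] unfolding ker .
qed

text \<open>
  The order must be positive here, as otherwise \<open>eta_order\<close> is a \<open>LEAST\<close> over the empty predicate.
\<close>

lemma (in field) admits_eta_covering_iff:
  assumes K: "subfield K R" and f: "f \<in> carrier (K[X])" "pirreducible K f"
    and root: "is_root f \<omega>" "\<omega> \<noteq> \<zero>" and ord: "group.ord (mult_of R) \<omega> > 0"
  shows "admits_eta_covering K f \<longleftrightarrow>
    (\<exists>V. subalgebra K V R \<and> V \<noteq> simple_extension K \<omega> \<and>
      (\<Union>z \<in> (\<lambda>i::nat. \<omega> [^] i) ` {0..<group.ord (mult_of R) \<omega>}. (\<lambda>v. z \<otimes> v) ` V)
        = simple_extension K \<omega>)"
proof -
  let ?Q = "Rupt K f" and ?E = "simple_extension K \<omega>" and ?T = "group.ord (mult_of R) \<omega>"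
  let ?F = "rupture_surj K f ` poly_of_const ` K"
  have \<omega>: "\<omega> \<in> carrier R"
    using root(1) unfolding is_root_def by auto
  have Ks: "subring K R"
    using subfieldE(1)[OF K] .
  obtain \<phi> where hom: "ring_hom_ring ?Q R \<phi>" and inj: "inj_on \<phi> (carrier ?Q)"
    and img: "\<phi> ` carrier ?Q = ?E"
    and \<phi>: "\<And>p. p \<in> carrier (K[X]) \<Longrightarrow> \<phi> (rupture_surj K f p) = eval p \<omega>"
    using rupture_eval[OF K f root(1)] by blast
  interpret h: ring_hom_ring ?Q R \<phi>
    by (rule hom)
  interpret Q: ring_hom_ring "K[X]" ?Q "rupture_surj K f"
    using rupture_surj_hom(2)[OF Ks f(1)] .
  have const: "poly_of_const k \<in> carrier (K[X])" "eval (poly_of_const k) \<omega> = k" if "k \<in> K" for k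
  proof -
    show "poly_of_const k \<in> carrier (K[X])"
      using canonical_embedding_is_hom[OF Ks] that unfolding ring_hom_def by auto
    show "eval (poly_of_const k) \<omega> = k"
      using \<omega> that subringE(1)[OF Ks] by (auto simp: poly_of_const_def)
  qed
  have F: "?F \<subseteq> carrier ?Q"
    using const(1) by auto
  \<comment> \<open>Constants evaluate to themselves, so subspaces over the image of
    \<open>K\<close> in the quotient correspond to \<open>K\<close>-subspaces.\<close>
  have \<phi>F: "\<phi> ` ?F = K"
    unfolding image_image using const by (simp add: \<phi>)
  have X: "rupture_surj K f X \<in> carrier ?Q"
    using var_closed(1)[OF Ks] by simp
  have eta: "eta K f A \<in> carrier ?Q" "\<phi> (eta K f A) = \<omega> \<otimes> \<phi> A" if "A \<in> carrier ?Q" for A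
    using X that \<phi>[OF var_closed(1)[OF Ks]] \<omega> by (simp_all add: eta_def eval_var)
  have pow: "(eta K f ^^ n) A \<in> carrier ?Q \<and> \<phi> ((eta K f ^^ n) A) = \<omega> [^] n \<otimes> \<phi> A"
    if "A \<in> carrier ?Q" for A n
    using that
  proof (induction n)
    case 0
    then show ?case by simp
  next
    case (Suc n)
    then show ?case
      using \<omega> eta[of "(eta K f ^^ n) A"] by (simp add: m_ac)
  qed
  have "(\<forall>A \<in> carrier ?Q. (eta K f ^^ n) A = A) \<longleftrightarrow> ?T dvd n" for n
  proof -
    interpret M: group "mult_of R"
      by (rule field_mult_group)
    have "(\<forall>A \<in> carrier ?Q. (eta K f ^^ n) A = A) \<longleftrightarrow> \<omega> [^] n = \<one>"
    proof
      assume "\<forall>A \<in> carrier ?Q. (eta K f ^^ n) A = A"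
      \<comment> \<open>It suffices to test the class of 1, whose image after \<open>n\<close> steps
        is \<omega>^n.\<close>
      then show "\<omega> [^] n = \<one>"
        using pow[of "\<one>\<^bsub>?Q\<^esub>" n] \<omega> by simp
    next
      assume one: "\<omega> [^] n = \<one>"
      show "\<forall>A \<in> carrier ?Q. (eta K f ^^ n) A = A"
      proof
        fix A
        assume A: "A \<in> carrier ?Q"
        have "\<phi> ((eta K f ^^ n) A) = \<phi> A"
          using pow[OF A, of n] h.hom_closed[OF A] one by simp
        with inj show "(eta K f ^^ n) A = A"
          using pow[OF A, of n] A by (blast dest: inj_onD)
      qed
    qed
    also have "\<dots> \<longleftrightarrow> ?T dvd n"
      using M.pow_eq_id[of \<omega> n] \<omega> root(2) by (simp add: Multiplicative_Group.nat_pow_mult_of)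
    finally show ?thesis .
  qed
  then have "eta_order K f = (LEAST n. 0 < n \<and> ?T dvd n)"
    unfolding eta_order_def by simp
  also have "\<dots> = ?T"
    using ord by (intro Least_equality) (auto dest: dvd_imp_le)
  finally have T: "eta_order K f = ?T" .
  \<comment> \<open>Injectivity of \<phi> makes the two equalities equivalent. Indexing by the set
    of powers rather than by exponents makes the right side depend on \<omega> only through that set
    and K(\<omega>).\<close>
  have cover: "(\<Union>i \<in> {0..<eta_order K f}. (eta K f ^^ i) ` U) = carrier ?Q \<longleftrightarrow>
      (\<Union>z \<in> (\<lambda>i::nat. \<omega> [^] i) ` {0..<?T}. (\<lambda>v. z \<otimes> v) ` \<phi> ` U) = ?E"
    if U: "U \<subseteq> carrier ?Q" for U
  proof -
    have eq: "\<phi> ` (eta K f ^^ i) ` U = (\<lambda>v. \<omega> [^] i \<otimes> v) ` \<phi> ` U" for i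
      unfolding image_image using pow U by (intro image_cong) auto
    have "(\<Union>i \<in> {0..<?T}. (eta K f ^^ i) ` U) \<subseteq> carrier ?Q"
      using pow U by (auto dest!: subsetD)
    then have "(\<Union>i \<in> {0..<?T}. (eta K f ^^ i) ` U) = carrier ?Q \<longleftrightarrow>
        \<phi> ` (\<Union>i \<in> {0..<?T}. (eta K f ^^ i) ` U) = \<phi> ` carrier ?Q"
      using inj_on_image_eq_iff[OF inj _ subset_refl] by simp
    then show ?thesis
      unfolding T img image_UN eq by simp
  qed
  show ?thesis
  proof
    assume "admits_eta_covering K f"
    then obtain U where U: "subalgebra ?F U ?Q" "U \<noteq> carrier ?Q"
      and UC: "(\<Union>i \<in> {0..<eta_order K f}. (eta K f ^^ i) ` U) = carrier ?Q"
      unfolding admits_eta_covering_def by blast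
    have sub: "U \<subseteq> carrier ?Q"
      using h.R.subalgebra_in_carrier[OF U(1)] .
    have "subalgebra K (\<phi> ` U) R"
      using h.img_is_subalgebra[OF F U(1)] unfolding \<phi>F .
    moreover have "\<phi> ` U \<noteq> ?E"
      using inj_on_image_eq_iff[OF inj sub subset_refl] U(2) img by simp
    ultimately show "\<exists>V. subalgebra K V R \<and> V \<noteq> ?E \<and>
        (\<Union>z \<in> (\<lambda>i::nat. \<omega> [^] i) ` {0..<?T}. (\<lambda>v. z \<otimes> v) ` V) = ?E"
      using iffD1[OF cover[OF sub] UC] by (intro exI[of _ "\<phi> ` U"] conjI)
  next
    assume "\<exists>V. subalgebra K V R \<and> V \<noteq> ?E \<and>
        (\<Union>z \<in> (\<lambda>i::nat. \<omega> [^] i) ` {0..<?T}. (\<lambda>v. z \<otimes> v) ` V) = ?E"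
    then obtain V where V: "subalgebra K V R" "V \<noteq> ?E"
      and VC: "(\<Union>z \<in> (\<lambda>i::nat. \<omega> [^] i) ` {0..<?T}. (\<lambda>v. z \<otimes> v) ` V) = ?E"
      by blast
    define U where "U = {A \<in> carrier ?Q. \<phi> A \<in> V}"
    have U: "U \<subseteq> carrier ?Q"
      by (auto simp: U_def)
    \<comment> \<open>A priori \<open>V\<close> is only a subspace of \<open>R\<close>. The exponent
      0, available because the order is positive, puts \<open>V\<close> itself into the union and
      hence into K(\<omega>).\<close>
    have "V \<subseteq> carrier R"
      using subalgebra_in_carrier[OF V(1)] .
    then have "V = (\<lambda>v. \<omega> [^] (0::nat) \<otimes> v) ` V"
      by (simp add: subset_iff image_def)
    moreover have "\<omega> [^] (0::nat) \<in> (\<lambda>i::nat. \<omega> [^] i) ` {0..<?T}"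
      using ord by (intro imageI) simp
    ultimately have "V \<subseteq> ?E"
      using VC by blast
    then have \<phi>U: "\<phi> ` U = V"
      unfolding U_def img[symmetric] by auto
    have "subalgebra ?F U ?Q"
      unfolding U_def by (rule h.vimage_is_subalgebra[OF F]) (simp only: \<phi>F V(1))
    moreover have "U \<noteq> carrier ?Q"
      using \<phi>U img V(2) by auto
    ultimately show "admits_eta_covering K f"
      unfolding admits_eta_covering_def
      using iffD2[OF cover[OF U, unfolded \<phi>U] VC] by (intro exI[of _ U] conjI)
  qed
qed

section \<open>Comparison of the two roots\<close>

theorem theorem3p7:
  fixes L :: "('a, 'b) ring_scheme" and K :: "'a set" and q :: nat
    and f1 f2 :: "'a list" and \<omega>1 \<omega>2 :: 'a
  assumes "primepow q"
    and "algebraic_closure L K" and "finite K" and "card K = q"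
    and "f1 \<in> carrier (K [X]\<^bsub>L\<^esub>)" and "f2 \<in> carrier (K [X]\<^bsub>L\<^esub>)"
    and "pirreducible\<^bsub>L\<^esub> K f1" and "pirreducible\<^bsub>L\<^esub> K f2"
    and "Polynomials.degree f1 = Polynomials.degree f2"
    and "ring.is_root L f1 \<omega>1" and "ring.is_root L f2 \<omega>2"
    and "\<omega>1 \<noteq> \<zero>\<^bsub>L\<^esub>" and "\<omega>2 \<noteq> \<zero>\<^bsub>L\<^esub>"
    and "group.ord (Multiplicative_Group.mult_of L) \<omega>1 = group.ord (Multiplicative_Group.mult_of L) \<omega>2"
  shows "ring.admits_eta_covering L K f1 \<longleftrightarrow> ring.admits_eta_covering L K f2"
proof -
  interpret algebraic_closure L K
    by (rule assms(2))
  have K: "subfield K L"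
    by (rule subfield_axioms)
  have Ks: "subring K L"
    using subfieldE(1)[OF K] .
  have \<omega>: "\<omega>1 \<in> carrier L" "\<omega>2 \<in> carrier L"
    using assms(10,11) unfolding is_root_def by auto
  \<comment> \<open>\<open>L\<close> is algebraically closed, hence infinite; \<open>M\<close> is a
    finite subfield that contains both roots.\<close>
  define M where "M = finite_extension K [\<omega>1, \<omega>2]"
  have alg: "(algebraic over K) x" if "x \<in> set [\<omega>1, \<omega>2]" for x
    using that \<omega> algebraic_extension by auto
  have set: "set [\<omega>1, \<omega>2] \<subseteq> carrier L"
    using \<omega> by simp
  have M: "subfield M L" "\<omega>1 \<in> M" "\<omega>2 \<in> M"
    unfolding M_def using finite_extension_is_subfield[OF K set alg] finite_extension_mem[OF Ks set]
    by auto
  have "finite_dimension K M"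
    unfolding M_def by (rule finite_extension_finite_dimension(1)[OF K set alg])
  then have fin: "finite M"
    using dimension_imp_finite assms(3) by blast
  note pow = powers_eq_if_same_ord[OF M(1) fin M(2) assms(12) M(3) assms(13,14)]
  have incl: "simple_extension K a \<subseteq> simple_extension K b"
    if ab: "a \<in> carrier L" "b \<in> carrier L" and a: "a \<in> range (\<lambda>i::nat. b [^]\<^bsub>L\<^esub> i)" for a b
  proof -
    have sub: "subring (simple_extension K b) L"
      using simple_extension_is_subring[OF Ks ab(2)] .
    \<comment> \<open>K(b) contains all powers of \<open>b\<close>, in particular \<open>a\<close>,
      and therefore K(a).\<close>
    have "b [^]\<^bsub>L\<^esub> i \<in> simple_extension K b" for i :: nat
      using simple_extension_mem[OF Ks ab(2)] subringE(3,6)[OF sub] by (induction i) auto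
    then show ?thesis
      using simple_extension_subring_incl[OF sub] simple_extension_incl[OF subringE(1)[OF Ks] ab(2)] a
      by blast
  qed
  \<comment> \<open>The exponent 1 works unless the order is 1, when it falls outside the range;
    then \<open>x\<close> is one and the exponent 0 serves.\<close>
  have self: "x \<in> (\<lambda>i::nat. x [^]\<^bsub>L\<^esub> i) ` {0..<group.ord (mult_of L) x}"
    if "x \<in> carrier L" "x \<noteq> \<zero>\<^bsub>L\<^esub>" "group.ord (mult_of L) x > 0" for x
  proof -
    interpret G: group "mult_of L"
      by (rule field_mult_group)
    show ?thesis
    proof (cases "G.ord x = 1")
      case True
      then show ?thesis
        using G.ord_eq_1[of x] that by simp
    next
      case False
      then show ?thesis
        using that by (intro image_eqI[of _ _ 1]) auto
    qed
  qed
  have ord2: "group.ord (mult_of L) \<omega>2 > 0"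
    using pow(2) assms(14) by simp
  \<comment> \<open>Each root is among its own powers, and the two sets of powers coincide.\<close>
  have "\<omega>1 \<in> range (\<lambda>i::nat. \<omega>2 [^]\<^bsub>L\<^esub> i)"
    using self[OF \<omega>(1) assms(12) pow(2)] image_mono[OF subset_UNIV] unfolding pow(1)
    by (rule rev_subsetD)
  moreover have "\<omega>2 \<in> range (\<lambda>i::nat. \<omega>1 [^]\<^bsub>L\<^esub> i)"
    using self[OF \<omega>(2) assms(13) ord2] image_mono[OF subset_UNIV] unfolding pow(1)[symmetric]
    by (rule rev_subsetD)
  ultimately have E: "simple_extension K \<omega>1 = simple_extension K \<omega>2"
    by (intro equalityI incl \<omega>)
  show ?thesis
    unfolding admits_eta_covering_iff[OF K assms(5,7,10,12) pow(2)]
      admits_eta_covering_iff[OF K assms(6,8,11,13) ord2] pow(1) E ..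
qed

end
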